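(* There exist functions $f, g \in VMOA$ such that $$|f'(z)| + |g'(z)| \geq \frac{1}{(1-|z|)\,\big|\log(1-|z|)\big|} \quad \text{for all } z \in \mathbb{D}.$$
   Context: $\mathbb{D}$ is the open unit disc of $\mathbb{C}$ and $\partial\mathbb{D}$ the unit circle. A function $f \in L^1(\partial\mathbb{D})$ belongs to $BMO$ if $$\|f\|_* := \sup_I \frac{1}{|I|}\int_I \big|f(e^{i\theta}) - m_I(f)\big|\,d\theta < \infty, \qquad m_I(f) = \frac{1}{|I|}\int_I f(e^{i\theta})\,d\theta,$$ where $I$ denotes an arbitrary interval (arc) of positive length $|I|$ contained in $\partial\mathbb{D}$. The space $VMO$ consists of those $f\in BMO$ for which $\frac{1}{|I|}\int_I |f(e^{i\theta}) - m_I(f)|\,d\theta$ tends to $0$ as $|I|\to 0$. The space $BMOA$ consists of those Poisson extensions to $\mathbb{D}$ of functions in $BMO$ that are analytic in $\mathbb{D}$, and $VMOA$ is defined in the same way with $VMO$ in place of $BMO$. $BMOA$ is endowed with the norm $\|f\|_{BMOA} = |f(0)| + \|f\|_*$, under which it is complete and $VMOA$ is a closed subspace.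
   Formalization: Since the right-hand side blows up as z tends to 0 while f', g' stay bounded, the inequality is proved for any fixed r in (0,1) with |log(1-|z|)| replaced by |log(1-r)| when |z|<r; it is unchanged for r ≤ |z| < 1, and f, g may depend on r. *)

theory Defs
  imports "HOL-Complex_Analysis.Complex_Analysis"
begin

text \<open>
  A function on the unit circle is represented by any \<open>\<phi> :: complex \<Rightarrow> complex\<close>; only its values
  \<open>\<phi> (cis \<theta>)\<close> are used, and only up to null sets of angles.  All integrals are Lebesgue integrals with
  respect to the completed measure, so that representatives need not be Borel.
\<close>

definition circle_L1 :: "(complex \<Rightarrow> complex) set" where
  "circle_L1 = {\<phi>. set_integrable lebesgue {-pi..pi} (\<lambda>\<theta>. \<phi> (cis \<theta>))}"

text \<open>
  A pair \<open>(a, b)\<close> stands for the arc \<open>cis ` {a..b}\<close>, of length \<open>b - a\<close>.  Since \<open>a\<close> is an arbitrary real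
  number, arcs through every point of the circle (in particular through \<open>-1\<close>) are included.
\<close>

definition arcs :: "(real \<times> real) set" where
  "arcs = {(a, b). a < b \<and> b \<le> a + 2 * pi}"

definition arc_mean :: "(complex \<Rightarrow> complex) \<Rightarrow> real \<Rightarrow> real \<Rightarrow> complex" where
  "arc_mean \<phi> a b = (LINT \<theta>:{a..b}|lebesgue. \<phi> (cis \<theta>)) / complex_of_real (b - a)"

definition mean_osc :: "(complex \<Rightarrow> complex) \<Rightarrow> real \<Rightarrow> real \<Rightarrow> real" where
  "mean_osc \<phi> a b = (LINT \<theta>:{a..b}|lebesgue. norm (\<phi> (cis \<theta>) - arc_mean \<phi> a b)) / (b - a)"

definition bmo_seminorm :: "(complex \<Rightarrow> complex) \<Rightarrow> ereal" where
  "bmo_seminorm \<phi> = (SUP (a, b)\<in>arcs. ereal (mean_osc \<phi> a b))"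

definition BMO :: "(complex \<Rightarrow> complex) set" where
  "BMO = {\<phi> \<in> circle_L1. bmo_seminorm \<phi> < \<infinity>}"

definition VMO :: "(complex \<Rightarrow> complex) set" where
  "VMO = {\<phi> \<in> BMO. \<forall>\<epsilon>>0. \<exists>\<delta>>0. \<forall>(a, b)\<in>arcs. b - a < \<delta> \<longrightarrow> mean_osc \<phi> a b < \<epsilon>}"

definition poisson_extension :: "(complex \<Rightarrow> complex) \<Rightarrow> complex \<Rightarrow> complex" where
  "poisson_extension \<phi> z =
     (LINT \<theta>:{-pi..pi}|lebesgue.
        complex_of_real ((1 - (norm z)\<^sup>2) / (norm (cis \<theta> - z))\<^sup>2) * \<phi> (cis \<theta>)) / complex_of_real (2 * pi)"

text \<open>Functions on the disc are total functions whose values outside the open unit disc are irrelevant.\<close>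

definition VMOA :: "(complex \<Rightarrow> complex) set" where
  "VMOA = {f. f holomorphic_on ball 0 1 \<and>
              (\<exists>\<phi>\<in>VMO. \<forall>z\<in>ball 0 1. f z = poisson_extension \<phi> z)}"

end

theory Submission
  imports Defs
begin

text \<open>
  Take \<open>F\<^sub>p(z) = \<Sum>\<^sub>n z\<^bsup>p Q\<^sup>n\<^esup> / (n + 1)\<close> with \<open>Q = q\<^sup>2\<close>, \<open>q = 100\<close>, and let \<open>f\<close>, \<open>g\<close> be large multiples of
  \<open>F\<^sub>1\<close> and \<open>F\<^sub>q\<close>.  When \<open>1 - |z|\<close> lies between \<open>1 / (q N)\<close> and \<open>1 / N\<close> for an exponent \<open>N = p Q\<^sup>n\<close>, the
  \<open>n\<close>-th term dominates the series of \<open>F\<^sub>p'\<close>, so \<open>|F\<^sub>p'(z)|\<close> is at least a constant times \<open>N / (n + 1)\<close>;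
  the exponents of \<open>F\<^sub>1\<close> and \<open>F\<^sub>q\<close> together cover all radii.  The coefficients are square summable,
  which gives membership in \<open>VMOA\<close>: on an arc \<open>I\<close>, the terms with \<open>N |I| < 1\<close> are almost constant, and
  the remaining ones are almost orthogonal in \<open>L\<^sup>2(I)\<close>.
\<close>

section \<open>Mean oscillation and Poisson extensions\<close>

lemma set_integrable_lebesgue_on:
  fixes f :: "real \<Rightarrow> 'a::{banach, second_countable_topology}"
  shows "set_integrable lebesgue {a..b} f \<longleftrightarrow> integrable (lebesgue_on {a..b}) f"
  by (simp add: set_integrable_def integrable_restrict_space)

lemma set_lebesgue_integral_lebesgue_on:
  fixes f :: "real \<Rightarrow> 'a::{banach, second_countable_topology}"
  shows "(LINT x:{a..b}|lebesgue. f x) = integral\<^sup>L (lebesgue_on {a..b}) f"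
  by (simp add: set_lebesgue_integral_def integral_restrict_space)

text \<open>By monotone convergence the summed norms have finite integral, so the series converges
  absolutely almost everywhere. The L^1 distance from the sum to the \<open>n\<close>-th partial sum
  is then at most a tail of the summable sequence of L^1 norms.\<close>

lemma integral_suminf_partial_L1:
  fixes u :: "nat \<Rightarrow> 'a \<Rightarrow> 'b::{banach, second_countable_topology}"
  assumes int: "\<And>k. integrable M (u k)"
    and sum: "summable (\<lambda>k. \<integral>x. norm (u k x) \<partial>M)"
  shows "integrable M (\<lambda>x. \<Sum>k. u k x)"
    and "(\<lambda>n. \<integral>x. norm ((\<Sum>k. u k x) - (\<Sum>k<n. u k x)) \<partial>M) \<longlonglongrightarrow> 0"
proof -
  have "(\<integral>\<^sup>+x. (\<Sum>k. ennreal (norm (u k x))) \<partial>M) = (\<Sum>k. \<integral>\<^sup>+x. ennreal (norm (u k x)) \<partial>M)"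
    using int by (intro nn_integral_suminf) auto
  also have "\<dots> = (\<Sum>k. ennreal (\<integral>x. norm (u k x) \<partial>M))"
    by (intro arg_cong[where f=suminf] ext nn_integral_eq_integral integrable_norm int) auto
  also have "\<dots> \<noteq> \<infinity>"
    using sum by (simp add: ennreal_suminf_neq_top)
  finally have "AE x in M. (\<Sum>k. ennreal (norm (u k x))) \<noteq> \<infinity>"
    using int by (intro nn_integral_PInf_AE) auto
  then have ae: "AE x in M. summable (\<lambda>k. norm (u k x))"
    by eventually_elim (simp add: summable_suminf_not_top)
  show intS: "integrable M (\<lambda>x. \<Sum>k. u k x)"
    by (rule integrable_suminf[OF int ae sum])
  have sum_n: "summable (\<lambda>k. \<integral>x. norm (u (k + n) x) \<partial>M)" for n
    by (rule summable_ignore_initial_segment[OF sum])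
  have ae_n: "AE x in M. summable (\<lambda>k. norm (u (k + n) x))" for n
    using ae by eventually_elim (rule summable_ignore_initial_segment)
  have le: "(\<integral>x. norm ((\<Sum>k. u k x) - (\<Sum>k<n. u k x)) \<partial>M) \<le> (\<Sum>k. \<integral>x. norm (u (k + n) x) \<partial>M)" for n
  proof -
    have i2: "integrable M (\<lambda>x. \<Sum>k. norm (u (k + n) x))"
      using ae_n sum_n int by (intro integrable_suminf) auto
    have "(\<integral>x. norm ((\<Sum>k. u k x) - (\<Sum>k<n. u k x)) \<partial>M) \<le> (\<integral>x. (\<Sum>k. norm (u (k + n) x)) \<partial>M)"
    proof (rule integral_mono_AE)
      show "integrable M (\<lambda>x. norm ((\<Sum>k. u k x) - (\<Sum>k<n. u k x)))"
        using intS int by auto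
      show "AE x in M. norm ((\<Sum>k. u k x) - (\<Sum>k<n. u k x)) \<le> (\<Sum>k. norm (u (k + n) x))"
        using ae ae_n[of n]
      proof eventually_elim
        fix x assume x: "summable (\<lambda>k. norm (u k x))" "summable (\<lambda>k. norm (u (k + n) x))"
        have "(\<Sum>k. u k x) - (\<Sum>k<n. u k x) = (\<Sum>k. u (k + n) x)"
          using suminf_minus_initial_segment[OF summable_norm_cancel[OF x(1)], of n] by simp
        then show "norm ((\<Sum>k. u k x) - (\<Sum>k<n. u k x)) \<le> (\<Sum>k. norm (u (k + n) x))"
          using summable_norm[OF x(2)] by simp
      qed
    qed (rule i2)
    also have "\<dots> = (\<Sum>k. \<integral>x. norm (u (k + n) x) \<partial>M)"
      using ae_n sum_n int by (intro integral_suminf) auto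
    finally show ?thesis .
  qed
  have tail: "(\<lambda>n. \<Sum>k. \<integral>x. norm (u (k + n) x) \<partial>M) \<longlonglongrightarrow> 0"
    using suminf_exist_split2[OF sum] .
  show "(\<lambda>n. \<integral>x. norm ((\<Sum>k. u k x) - (\<Sum>k<n. u k x)) \<partial>M) \<longlonglongrightarrow> 0"
    by (rule tendsto_sandwich[OF _ _ tendsto_const tail]) (use le in auto)
qed

text \<open>Replacing the mean by another constant \<open>c\<close> costs at most a factor 2,
  because the distance from \<open>c\<close> to the mean is itself bounded by the average of
  \<open>norm (\<phi> - c)\<close>. Oscillation can thus be estimated with any convenient
  \<open>c\<close>.\<close>

lemma mean_osc_le:
  assumes "a < b" and int: "integrable (lebesgue_on {a..b}) (\<lambda>\<theta>. \<phi> (cis \<theta>))"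
  shows "mean_osc \<phi> a b \<le> 2 * (\<integral>\<theta>. norm (\<phi> (cis \<theta>) - c) \<partial>lebesgue_on {a..b}) / (b - a)"
proof -
  let ?M = "lebesgue_on {a..b}" and ?m = "arc_mean \<phi> a b"
  interpret finite_measure ?M by (rule finite_measure_lebesgue_on) simp
  have meas: "measure ?M {a..b} = b - a"
    using assms by (simp add: measure_restrict_space)
  have intc: "integrable ?M (\<lambda>\<theta>. \<phi> (cis \<theta>) - d)" for d
    using int by simp
  have "c - ?m = - (\<integral>\<theta>. \<phi> (cis \<theta>) - c \<partial>?M) / of_real (b - a)"
    using assms int
    by (simp add: arc_mean_def set_lebesgue_integral_lebesgue_on meas field_simps scaleR_conv_of_real)
  then have "norm (c - ?m) = norm (\<integral>\<theta>. \<phi> (cis \<theta>) - c \<partial>?M) / (b - a)"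
    using assms(1) by (simp add: norm_divide flip: of_real_diff)
  also have "\<dots> \<le> (\<integral>\<theta>. norm (\<phi> (cis \<theta>) - c) \<partial>?M) / (b - a)"
    using assms(1) by (intro divide_right_mono integral_norm_bound) auto
  finally have cm: "norm (c - ?m) * (b - a) \<le> (\<integral>\<theta>. norm (\<phi> (cis \<theta>) - c) \<partial>?M)"
    using assms(1) by (simp add: field_simps)
  have "(\<integral>\<theta>. norm (\<phi> (cis \<theta>) - ?m) \<partial>?M) \<le> (\<integral>\<theta>. norm (\<phi> (cis \<theta>) - c) + norm (c - ?m) \<partial>?M)"
  proof (rule integral_mono)
    show "norm (\<phi> (cis \<theta>) - ?m) \<le> norm (\<phi> (cis \<theta>) - c) + norm (c - ?m)" for \<theta>
      using norm_triangle_ineq[of "\<phi> (cis \<theta>) - c" "c - ?m"] by simp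
  qed (use intc in auto)
  also have "\<dots> = (\<integral>\<theta>. norm (\<phi> (cis \<theta>) - c) \<partial>?M) + norm (c - ?m) * (b - a)"
    using intc meas by simp
  also have "\<dots> \<le> 2 * (\<integral>\<theta>. norm (\<phi> (cis \<theta>) - c) \<partial>?M)"
    using cm by simp
  finally show ?thesis
    using assms(1) unfolding mean_osc_def set_lebesgue_integral_lebesgue_on
    by (intro divide_right_mono) auto
qed

lemma VMOI:
  assumes int: "\<And>a b. a < b \<Longrightarrow> b \<le> a + 2 * pi \<Longrightarrow> integrable (lebesgue_on {a..b}) (\<lambda>\<theta>. \<phi> (cis \<theta>))"
    and bdd: "\<And>a b. a < b \<Longrightarrow> b \<le> a + 2 * pi \<Longrightarrow> mean_osc \<phi> a b \<le> B"
    and small: "\<And>\<epsilon>. \<epsilon> > 0 \<Longrightarrow> \<exists>\<delta>>0. \<forall>a b. a < b \<longrightarrow> b \<le> a + 2 * pi \<longrightarrow> b - a < \<delta> \<longrightarrow> mean_osc \<phi> a b < \<epsilon>"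
  shows "\<phi> \<in> VMO"
proof -
  have "\<phi> \<in> circle_L1"
    using int[of "-pi" pi] by (simp add: circle_L1_def set_integrable_lebesgue_on)
  moreover have "bmo_seminorm \<phi> \<le> ereal B"
    unfolding bmo_seminorm_def by (intro SUP_least) (auto simp: arcs_def bdd)
  then have "bmo_seminorm \<phi> < \<infinity>"
    using le_less_trans by fastforce
  moreover have "\<exists>\<delta>>0. \<forall>(a, b)\<in>arcs. b - a < \<delta> \<longrightarrow> mean_osc \<phi> a b < \<epsilon>" if "\<epsilon> > 0" for \<epsilon>
    using small[OF that] by (force simp: arcs_def)
  ultimately show ?thesis
    by (auto simp: VMO_def BMO_def)
qed

text \<open>
  Cauchy's formula at \<open>-z\<close> for \<open>w \<mapsto> p(-w) (1 - |z|\<^sup>2) / (1 + cnj z * w)\<close>, whose restriction to the circle turns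
  the Cauchy kernel into the Poisson kernel.  The reflection moves the circle path, parametrised
  by \<open>{0..2 * pi}\<close>, to \<open>{-pi..pi}\<close>.
\<close>

lemma poisson_extension_of_holomorphic:
  assumes cont: "continuous_on (cball 0 1) p" and hol: "p holomorphic_on ball 0 1" and z: "norm z < 1"
  shows "poisson_extension p z = p z"
proof -
  define K where "K w = of_real ((1 - (norm z)\<^sup>2) / (norm (w - z))\<^sup>2) * p w" for w
  define h where "h w = p (- w) * (1 - z * cnj z) / (1 + cnj z * w)" for w
  have nz: "1 + cnj z * w \<noteq> 0" if "norm w \<le> 1" for w
  proof
    assume "1 + cnj z * w = 0"
    then have "cnj z * w = -1" by (simp add: add_eq_0_iff)
    then have "norm z * norm w = 1" by (metis complex_mod_cnj norm_minus_cancel norm_mult norm_one)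
    moreover have "norm z * norm w \<le> norm z * 1" using that by (intro mult_left_mono) auto
    ultimately show False using z by simp
  qed
  have conth: "continuous_on (cball 0 1) h"
    unfolding h_def using nz
    by (intro continuous_intros continuous_on_compose2[OF cont]) auto
  have holh: "h holomorphic_on ball 0 1"
  proof -
    have "(p \<circ> uminus) holomorphic_on ball 0 1"
      by (intro holomorphic_on_compose_gen[OF _ hol]) (auto intro!: holomorphic_intros)
    then show ?thesis
      unfolding h_def using nz by (intro holomorphic_intros) (auto simp: o_def)
  qed
  have "((\<lambda>u. h u / (u - (- z))) has_contour_integral (2 * of_real pi * \<i> * h (- z))) (circlepath 0 1)"
    by (rule Cauchy_integral_circlepath[OF conth holh]) (use z in simp)
  \<comment> \<open>At \<open>- z\<close> the denominator of \<open>h\<close> equals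
    \<open>1 - z * cnj z\<close> and cancels the normalising factor.\<close>
  moreover have "h (- z) = p z"
    using nz[of "- z"] z by (simp add: h_def mult.commute)
  ultimately have "((\<lambda>t. h (cis t) / (cis t + z) * \<i> * cis t) has_integral (2 * of_real pi * \<i> * p z)) {0..2 * pi}"
    by (simp add: circlepath_def has_contour_integral_part_circlepath_iff)
  from has_integral_divide[OF this, of \<i>]
  have 1: "((\<lambda>t. h (cis t) / (cis t + z) * cis t) has_integral (2 * of_real pi * p z)) {0..2 * pi}"
    by (simp add: mult_ac)
  have eq: "h (cis t) / (cis t + z) * cis t = K (- cis t)" for t
  proof -
    have c: "cis t * cnj (cis t) = 1" by (simp add: cis_cnj cis_mult)
    have n: "cis t + z \<noteq> 0"
      using z by (metis add_eq_0_iff norm_cis norm_minus_cancel less_irrefl)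
    have n': "cnj (cis t + z) \<noteq> 0" using n by (metis complex_cnj_zero_iff)
    define d where "d = cis t + z"
    have d: "d \<noteq> 0" "cnj d \<noteq> 0" using n n' by (auto simp: d_def)
    \<comment> \<open>Since \<open>cis t\<close> and \<open>cnj (cis t)\<close> are inverse to each
      other, the two denominators multiply to \<open>cis t * d * cnj d\<close>. The extra
      \<open>cis t\<close> cancels the one coming from the parametrisation of the circle.\<close>
    have "1 + cnj z * cis t = cis t * cnj d" using c by (simp add: d_def algebra_simps)
    moreover have "of_real ((norm (- cis t - z))\<^sup>2) = d * cnj d"
      unfolding d_def
      by (metis complex_norm_square minus_add_distrib norm_minus_cancel diff_conv_add_uminus)
    moreover have "complex_of_real (1 - (norm z)\<^sup>2) = 1 - z * cnj z"
      by (metis complex_norm_square of_real_1 of_real_diff)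
    ultimately have "h (cis t) = p (- cis t) * (1 - z * cnj z) / (cis t * cnj d)"
      and "K (- cis t) = (1 - z * cnj z) / (d * cnj d) * p (- cis t)"
      unfolding h_def K_def of_real_divide by simp_all
    then show ?thesis
      using d by (simp add: mult.commute flip: d_def)
  qed
  have "((\<lambda>t. K (- cis (t + pi))) has_integral (2 * of_real pi * p z)) {0 - pi..2 * pi - pi}"
    using 1 unfolding eq by (rule has_integral_shift_real_ivl)
  moreover have "- cis (t + pi) = cis t" for t
    by (simp flip: cis_mult)
  ultimately have hi: "((\<lambda>t. K (cis t)) has_integral (2 * of_real pi * p z)) {-pi..pi}"
    by simp
  have "cis t - z \<noteq> 0" for t
    using z by (metis eq_iff_diff_eq_0 norm_cis less_irrefl)
  then have "continuous_on {-pi..pi} (\<lambda>t. K (cis t))"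
    unfolding K_def
    by (intro continuous_intros continuous_on_compose2[OF cont] continuous_on_cis) auto
  then have "set_integrable lebesgue {-pi..pi} (\<lambda>t. K (cis t))"
    by (rule absolutely_integrable_continuous_real)
  then have "(LINT t:{-pi..pi}|lebesgue. K (cis t)) = 2 * of_real pi * p z"
    using hi by (simp add: set_lebesgue_integral_eq_integral(2) integral_unique)
  then show ?thesis
    by (simp add: poisson_extension_def K_def)
qed

text \<open>For fixed \<open>z\<close> the Poisson kernel is bounded, so the extension at
  \<open>z\<close> is continuous in the L^1 norm of the boundary values. The approximants
  \<open>p k\<close> reproduce themselves, hence the extension of their limit is the pointwise limit
  inside the disc.\<close>

lemma poisson_extension_L1_limit:
  fixes p :: "nat \<Rightarrow> complex \<Rightarrow> complex"
  assumes cont: "\<And>k. continuous_on (cball 0 1) (p k)" and hol: "\<And>k. p k holomorphic_on ball 0 1"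
    and int: "integrable (lebesgue_on {-pi..pi}) (\<lambda>\<theta>. \<phi> (cis \<theta>))"
    and lim: "(\<lambda>k. \<integral>\<theta>. norm (\<phi> (cis \<theta>) - p k (cis \<theta>)) \<partial>lebesgue_on {-pi..pi}) \<longlonglongrightarrow> 0"
    and z: "norm z < 1" and pF: "(\<lambda>k. p k z) \<longlonglongrightarrow> F"
  shows "poisson_extension \<phi> z = F"
proof -
  let ?M = "lebesgue_on {-pi..pi}"
  define K where "K \<theta> = (1 - (norm z)\<^sup>2) / (norm (cis \<theta> - z))\<^sup>2" for \<theta>
  define B where "B = (1 - (norm z)\<^sup>2) / (1 - norm z)\<^sup>2"
  have z2: "(norm z)\<^sup>2 \<le> 1" using z by (simp add: power_le_one)
  have nz: "cis t - z \<noteq> 0" for t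
    using z by (metis eq_iff_diff_eq_0 norm_cis less_irrefl)
  have KB: "norm (complex_of_real (K \<theta>)) \<le> B" for \<theta>
  proof -
    have "1 - norm z \<le> norm (cis \<theta> - z)"
      using norm_triangle_ineq2[of "cis \<theta>" z] by simp
    then have "(1 - norm z)\<^sup>2 \<le> (norm (cis \<theta> - z))\<^sup>2"
      using z by (intro power_mono) auto
    then show ?thesis
      unfolding K_def B_def norm_of_real using z z2
      by (simp add: frac_le)
  qed
  have measK: "(\<lambda>\<theta>. complex_of_real (K \<theta>)) \<in> borel_measurable ?M"
  proof -
    have "continuous_on (cbox (-pi) pi) (\<lambda>\<theta>. complex_of_real (K \<theta>))"
      unfolding K_def using nz by (intro continuous_intros continuous_on_cis) auto
    from continuous_imp_integrable[OF this] show ?thesis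
      by (simp add: borel_measurable_integrable)
  qed
  have intK: "integrable ?M (\<lambda>\<theta>. complex_of_real (K \<theta>) * f \<theta>)" if f: "integrable ?M f" for f
  proof (rule Bochner_Integration.integrable_bound)
    show "integrable ?M (\<lambda>\<theta>. of_real B * f \<theta>)" using f by simp
    show "(\<lambda>\<theta>. complex_of_real (K \<theta>) * f \<theta>) \<in> borel_measurable ?M"
      using measK f by (intro borel_measurable_times) auto
    have "B \<ge> 0" using KB order_trans[OF norm_ge_zero] by blast
    then show "AE \<theta> in ?M. norm (complex_of_real (K \<theta>) * f \<theta>) \<le> norm (of_real B * f \<theta>)"
      using KB by (intro AE_I2) (simp add: norm_mult mult_right_mono)
  qed
  have intp: "integrable ?M (\<lambda>\<theta>. p k (cis \<theta>))" for k
  proof -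
    have "continuous_on (cbox (-pi) pi) (\<lambda>\<theta>. p k (cis \<theta>))"
      by (rule continuous_on_compose2[OF cont]) (auto intro!: continuous_intros)
    from continuous_imp_integrable[OF this] show ?thesis by simp
  qed
  have pe: "poisson_extension f z = (\<integral>\<theta>. complex_of_real (K \<theta>) * f (cis \<theta>) \<partial>?M) / of_real (2 * pi)" for f
    by (simp add: poisson_extension_def set_lebesgue_integral_lebesgue_on K_def)
  have le: "norm (poisson_extension \<phi> z - p k z)
      \<le> B * (\<integral>\<theta>. norm (\<phi> (cis \<theta>) - p k (cis \<theta>)) \<partial>?M) / (2 * pi)" for k
  proof -
    have "poisson_extension \<phi> z - p k z = poisson_extension \<phi> z - poisson_extension (p k) z"
      by (simp add: poisson_extension_of_holomorphic[OF cont hol z])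
    also have "\<dots> = (\<integral>\<theta>. complex_of_real (K \<theta>) * (\<phi> (cis \<theta>) - p k (cis \<theta>)) \<partial>?M) / of_real (2 * pi)"
      unfolding pe using intK[OF int] intK[OF intp]
      by (simp add: right_diff_distrib diff_divide_distrib)
    finally have "norm (poisson_extension \<phi> z - p k z)
        = norm (\<integral>\<theta>. complex_of_real (K \<theta>) * (\<phi> (cis \<theta>) - p k (cis \<theta>)) \<partial>?M) / (2 * pi)"
      by (simp add: norm_divide norm_mult)
    also have "\<dots> \<le> (\<integral>\<theta>. norm (complex_of_real (K \<theta>) * (\<phi> (cis \<theta>) - p k (cis \<theta>))) \<partial>?M) / (2 * pi)"
      by (intro divide_right_mono integral_norm_bound) auto
    also have "\<dots> \<le> (\<integral>\<theta>. B * norm (\<phi> (cis \<theta>) - p k (cis \<theta>)) \<partial>?M) / (2 * pi)"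
    proof (intro divide_right_mono integral_mono)
      show "integrable ?M (\<lambda>\<theta>. norm (complex_of_real (K \<theta>) * (\<phi> (cis \<theta>) - p k (cis \<theta>))))"
        using int intp by (intro integrable_norm intK) auto
      show "integrable ?M (\<lambda>\<theta>. B * norm (\<phi> (cis \<theta>) - p k (cis \<theta>)))"
        using int intp by auto
    qed (use KB in \<open>auto simp: norm_mult intro!: mult_right_mono\<close>)
    finally show ?thesis by simp
  qed
  have "(\<lambda>k. B * (\<integral>\<theta>. norm (\<phi> (cis \<theta>) - p k (cis \<theta>)) \<partial>?M) / (2 * pi)) \<longlonglongrightarrow> B * 0 / (2 * pi)"
    by (intro tendsto_intros lim) simp
  then have "(\<lambda>k. B * (\<integral>\<theta>. norm (\<phi> (cis \<theta>) - p k (cis \<theta>)) \<partial>?M) / (2 * pi)) \<longlonglongrightarrow> 0"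
    by simp
  then have "(\<lambda>k. poisson_extension \<phi> z - p k z) \<longlonglongrightarrow> 0"
    by (rule Lim_null_comparison[rotated]) (use le in auto)
  then have "(\<lambda>k. p k z) \<longlonglongrightarrow> poisson_extension \<phi> z"
    using tendsto_diff[OF tendsto_const[of "poisson_extension \<phi> z"]] by fastforce
  then show ?thesis
    using pF LIMSEQ_unique by blast
qed

section \<open>Almost orthogonality of lacunary exponentials on arcs\<close>

lemma integral_cos_le:
  fixes a b k :: real
  assumes "k \<noteq> 0" "a \<le> b"
  shows "\<bar>\<integral>\<theta>. cos (k * \<theta>) \<partial>lebesgue_on {a..b}\<bar> \<le> 2 / \<bar>k\<bar>"
proof -
  have "((\<lambda>\<theta>. cos (k * \<theta>)) has_integral (sin (k * b) / k - sin (k * a) / k)) {a..b}"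
    using assms
    by (intro fundamental_theorem_of_calculus)
       (auto intro!: derivative_eq_intros simp flip: has_real_derivative_iff_has_vector_derivative)
  moreover have "integrable (lebesgue_on {a..b}) (\<lambda>\<theta>. cos (k * \<theta>))"
    using continuous_imp_integrable[of a b "\<lambda>\<theta>. cos (k * \<theta>)"] by (simp add: continuous_intros)
  ultimately have "(\<integral>\<theta>. cos (k * \<theta>) \<partial>lebesgue_on {a..b}) = (sin (k * b) - sin (k * a)) / k"
    by (simp add: lebesgue_integral_eq_integral integral_unique diff_divide_distrib)
  moreover have "\<bar>sin (k * b) - sin (k * a)\<bar> \<le> 2"
    using abs_sin_le_one[of "k * b"] abs_sin_le_one[of "k * a"] by linarith
  ultimately show ?thesis
    by (simp add: divide_right_mono)
qed

lemma lacunary_growth: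
  fixes N :: "nat \<Rightarrow> nat"
  assumes "\<And>n. 2 * N n \<le> N (Suc n)" and "m \<le> n"
  shows "2 ^ (n - m) * N m \<le> N n"
  using assms(2)
proof (induction n rule: dec_induct)
  case (step n)
  then show ?case
    using assms(1)[of n] by (simp add: Suc_diff_le)
qed simp

text \<open>Comparison with the geometric series of ratio 1/2 starting at
  \<open>1 / N M\<close>.\<close>

lemma sum_inverse_lacunary:
  fixes N :: "nat \<Rightarrow> nat"
  assumes N: "\<And>n. 2 * N n \<le> N (Suc n)" and pos: "N M > 0"
  shows "(\<Sum>m\<in>{M..<K}. 1 / real (N m)) \<le> 2 / N M"
proof -
  have "(\<Sum>m\<in>{M..<K}. 1 / real (N m)) \<le> (\<Sum>m\<in>{M..<K}. 1 / N M * (1 / 2) ^ (m - M))"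
  proof (rule sum_mono)
    fix m assume "m \<in> {M..<K}"
    then have "real (2 ^ (m - M) * N M) \<le> real (N m)"
      using lacunary_growth[of N M m, OF N] by (intro of_nat_mono) auto
    then have "1 / real (N m) \<le> 1 / (2 ^ (m - M) * real (N M))"
      using pos by (intro frac_le) simp_all
    then show "1 / real (N m) \<le> 1 / N M * (1 / 2) ^ (m - M)"
      by (simp add: power_divide mult.commute)
  qed
  also have "\<dots> = 1 / N M * (\<Sum>i<K - M. (1 / 2) ^ i)"
    by (subst sum.atLeastLessThan_shift_0) (simp add: sum_distrib_left lessThan_atLeast0)
  also have "\<dots> \<le> 1 / N M * 2"
    by (intro mult_left_mono) (auto simp: sum_gp_strict)
  finally show ?thesis by simp
qed

text \<open>Schur's test. Expanding the square gives a quadratic form in \<open>c\<close> whose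
  matrix \<open>I\<close> of cosine integrals has diagonal \<open>b - a\<close>. By lacunarity the
  off-diagonal entries of each row sum to at most \<open>8 / N M\<close> in absolute value.\<close>

lemma integral_norm_sq_lacunary:
  fixes N :: "nat \<Rightarrow> nat" and c :: "nat \<Rightarrow> real"
  assumes N: "\<And>n. 2 * N n \<le> N (Suc n)" and pos: "N M > 0" and ab: "a < b"
  shows "(\<integral>\<theta>. (norm (\<Sum>n\<in>{M..<K}. of_real (c n) * cis \<theta> ^ N n))\<^sup>2 \<partial>lebesgue_on {a..b})
           \<le> (b - a + 8 / N M) * (\<Sum>n\<in>{M..<K}. (c n)\<^sup>2)"
proof -
  let ?L = "lebesgue_on {a..b}" and ?A = "{M..<K}"
  define I where "I n m = (\<integral>\<theta>. cos ((real (N n) - real (N m)) * \<theta>) \<partial>?L)" for n m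
  have int: "integrable ?L (\<lambda>\<theta>. cos (k * \<theta>))" for k
    using continuous_imp_integrable[of a b "\<lambda>\<theta>. cos (k * \<theta>)"] by (simp add: continuous_intros)
  have cis_pow: "Re (cis \<theta> ^ n) = cos (n * \<theta>) \<and> Im (cis \<theta> ^ n) = sin (n * \<theta>)" for \<theta> n
    by (simp only: Complex.DeMoivre cis.sel simp_thms)
  have sq: "(norm (\<Sum>n\<in>?A. of_real (c n) * cis \<theta> ^ N n))\<^sup>2
      = (\<Sum>n\<in>?A. \<Sum>m\<in>?A. c n * c m * cos ((real (N n) - real (N m)) * \<theta>))" for \<theta>
    unfolding cmod_power2
    by (simp add: cis_pow power2_eq_square sum_product sum.distrib[symmetric] cos_diff algebra_simps)
  have I_bound: "(\<Sum>m\<in>?A. \<bar>I n m\<bar>) \<le> b - a + 8 / N M" if n: "n \<in> ?A" for n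
  proof -
    have "\<bar>I n m\<bar> \<le> 4 * (1 / N m)" if m: "m \<in> ?A - {n}" for m
    proof -
      have p: "N m > 0"
        using m lacunary_growth[of N M m, OF N] pos by (auto intro: gr0I)
      \<comment> \<open>The larger of the two frequencies is at least twice the smaller, so their
        gap is at least half the larger and in particular at least \<open>N m / 2\<close>. A bound
        in terms of \<open>m\<close> alone is what can be summed over a row.\<close>
      have d: "\<bar>real (N n) - real (N m)\<bar> \<ge> N m / 2"
      proof (cases "m < n")
        case True
        have "2 * N m \<le> 2 ^ (n - m) * N m"
          using True power_increasing[of 1 "n - m" "2::nat"] by auto
        also have "\<dots> \<le> N n" using True by (intro lacunary_growth N) simp
        finally show ?thesis by linarith
      next
        case False
        have "2 * N n \<le> 2 ^ (m - n) * N n"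
          using False m power_increasing[of 1 "m - n" "2::nat"] by auto
        also have "\<dots> \<le> N m" using False by (intro lacunary_growth N) simp
        finally show ?thesis by linarith
      qed
      have "\<bar>I n m\<bar> \<le> 2 / \<bar>real (N n) - real (N m)\<bar>"
        unfolding I_def using d p ab by (intro integral_cos_le) auto
      also have "\<dots> \<le> 2 / (N m / 2)"
        using d p by (intro divide_left_mono) (auto intro!: mult_pos_pos)
      finally show ?thesis by simp
    qed
    then have "(\<Sum>m\<in>?A - {n}. \<bar>I n m\<bar>) \<le> (\<Sum>m\<in>?A - {n}. 4 * (1 / N m))"
      by (rule sum_mono)
    also have "\<dots> \<le> (\<Sum>m\<in>?A. 4 * (1 / N m))"
      by (rule sum_mono2) auto
    also have "\<dots> = 4 * (\<Sum>m\<in>?A. 1 / N m)"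
      by (simp add: sum_distrib_left)
    also have "\<dots> \<le> 8 / N M"
      using sum_inverse_lacunary[OF N pos, of K] by simp
    finally have "(\<Sum>m\<in>?A - {n}. \<bar>I n m\<bar>) \<le> 8 / N M" .
    moreover have "I n n = b - a"
      using ab by (simp add: I_def measure_restrict_space)
    ultimately show ?thesis
      using n ab by (subst sum.remove[of _ n]) auto
  qed
  have "(\<integral>\<theta>. (norm (\<Sum>n\<in>?A. of_real (c n) * cis \<theta> ^ N n))\<^sup>2 \<partial>?L)
      = (\<Sum>n\<in>?A. \<Sum>m\<in>?A. c n * c m * I n m)"
    unfolding sq I_def using int by (simp add: Bochner_Integration.integral_sum)
  \<comment> \<open>The products \<open>c n * c m\<close> are split by AM-GM. Since \<open>I\<close>
    is symmetric, both halves give the same double sum, and only the row sums of \<open>I\<close>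
    remain to be bounded.\<close>
  also have "\<dots> \<le> (\<Sum>n\<in>?A. \<Sum>m\<in>?A. ((c n)\<^sup>2 + (c m)\<^sup>2) / 2 * \<bar>I n m\<bar>)"
  proof (intro sum_mono)
    fix n m
    have "\<bar>c n * c m\<bar> \<le> ((c n)\<^sup>2 + (c m)\<^sup>2) / 2"
      using sum_squares_bound[of "\<bar>c n\<bar>" "\<bar>c m\<bar>"] by (simp add: abs_mult)
    then have "\<bar>c n * c m\<bar> * \<bar>I n m\<bar> \<le> ((c n)\<^sup>2 + (c m)\<^sup>2) / 2 * \<bar>I n m\<bar>"
      by (rule mult_right_mono) simp
    then show "c n * c m * I n m \<le> ((c n)\<^sup>2 + (c m)\<^sup>2) / 2 * \<bar>I n m\<bar>"
      by (metis abs_ge_self abs_mult order_trans)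
  qed
  also have "\<dots> = (\<Sum>n\<in>?A. \<Sum>m\<in>?A. (c n)\<^sup>2 / 2 * \<bar>I n m\<bar>) + (\<Sum>n\<in>?A. \<Sum>m\<in>?A. (c m)\<^sup>2 / 2 * \<bar>I n m\<bar>)"
    by (simp add: sum.distrib[symmetric] add_divide_distrib distrib_right)
  also have "(\<Sum>n\<in>?A. \<Sum>m\<in>?A. (c m)\<^sup>2 / 2 * \<bar>I n m\<bar>) = (\<Sum>n\<in>?A. \<Sum>m\<in>?A. (c n)\<^sup>2 / 2 * \<bar>I n m\<bar>)"
  proof -
    have "I n m = I m n" for n m
      unfolding I_def by (metis cos_minus minus_diff_eq minus_mult_left)
    then show ?thesis by (subst sum.swap) simp
  qed
  also have "(\<Sum>n\<in>?A. \<Sum>m\<in>?A. (c n)\<^sup>2 / 2 * \<bar>I n m\<bar>) + (\<Sum>n\<in>?A. \<Sum>m\<in>?A. (c n)\<^sup>2 / 2 * \<bar>I n m\<bar>)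
      = (\<Sum>n\<in>?A. (c n)\<^sup>2 * (\<Sum>m\<in>?A. \<bar>I n m\<bar>))"
    by (simp add: sum_distrib_left mult.commute flip: sum.distrib)
  also have "\<dots> \<le> (\<Sum>n\<in>?A. (c n)\<^sup>2 * (b - a + 8 / N M))"
    using I_bound by (intro sum_mono mult_left_mono) auto
  finally show ?thesis
    by (simp add: mult.commute flip: sum_distrib_right)
qed

section \<open>Boundary values of the lacunary series\<close>

text \<open>The ratio 10000 is the square of 100, so \<open>p = 1\<close> and \<open>p = 100\<close>
  produce the even and the odd powers of 100.\<close>

definition lac :: "nat \<Rightarrow> nat \<Rightarrow> nat" where
  "lac p n = p * 10000 ^ n"

definition lac_poly :: "nat \<Rightarrow> nat \<Rightarrow> nat \<Rightarrow> complex \<Rightarrow> complex" where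
  "lac_poly p M K w = (\<Sum>n\<in>{M..<K}. complex_of_real (1 / real (n + 1)) * w ^ lac p n)"

text \<open>
  The Fourier series need not converge absolutely, but the \<open>L\<^sup>1\<close> norms of these blocks decay
  geometrically, so that the sum of the blocks converges almost everywhere.
\<close>

definition lac_boundary :: "nat \<Rightarrow> complex \<Rightarrow> complex" where
  "lac_boundary p w = (\<Sum>k. lac_poly p (4 ^ k - 1) (4 ^ Suc k - 1) w)"

definition lac_fun :: "nat \<Rightarrow> complex \<Rightarrow> complex" where
  "lac_fun p z = (\<Sum>n. complex_of_real (1 / real (n + 1)) * z ^ lac p n)"

lemma lac_Suc: "lac p (Suc n) = 10000 * lac p n"
  by (simp add: lac_def)

lemma lac_pos: "p > 0 \<Longrightarrow> lac p n > 0"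
  by (simp add: lac_def)

lemma lac_mono: "m \<le> n \<Longrightarrow> lac p m \<le> lac p n"
  by (simp add: lac_def power_increasing)

text \<open>Each square is at most the difference of two consecutive values of
  \<open>2 / (n + 1)\<close>, so the sum telescopes.\<close>

lemma sum_inverse_squares_le: "(\<Sum>n\<in>{M..<K}. (1 / real (n + 1))\<^sup>2) \<le> 2 / (real M + 1)"
proof (cases "M \<le> K")
  case True
  then have "(\<Sum>n\<in>{M..<K}. (1 / real (n + 1))\<^sup>2) \<le> 2 / (real M + 1) - 2 / (real K + 1)"
  proof (induction K rule: dec_induct)
    case (step K)
    have "(1 / real (K + 1))\<^sup>2 \<le> 2 / (real K + 1) - 2 / (real (Suc K) + 1)"
      by (simp add: divide_simps power2_eq_square) (simp add: algebra_simps)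
    with step show ?case by simp
  qed simp
  then show ?thesis by (rule order_trans) simp
qed simp

lemma continuous_on_lac_poly: "continuous_on A (lac_poly p M K)"
  unfolding lac_poly_def by (intro continuous_intros)

lemma holomorphic_on_lac_poly: "lac_poly p M K holomorphic_on A"
  unfolding lac_poly_def by (intro holomorphic_intros)

lemma integrable_lac_poly: "integrable (lebesgue_on {a..b}) (\<lambda>\<theta>. lac_poly p M K (cis \<theta>))"
proof -
  have "continuous_on (cbox a b) (\<lambda>\<theta>. lac_poly p M K (cis \<theta>))"
    by (rule continuous_on_compose2[OF continuous_on_lac_poly[of UNIV]]) (auto intro!: continuous_intros)
  from continuous_imp_integrable[OF this] show ?thesis by simp
qed

section \<open>High-frequency blocks in L^1 and Lipschitz bounds for low frequencies\<close>

lemma measure_lebesgue_on_Icc: "a \<le> b \<Longrightarrow> measure (lebesgue_on {a..b}) {a..b} = b - (a::real)"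
  by (simp add: measure_restrict_space)

text \<open>Almost orthogonality bounds the L^2 norm by the tail of the squared coefficients, which
  is of order \<open>1 / (M + 1)\<close>. The constant \<open>C\<close> measures the loss from the
  off-diagonal terms; it stays bounded as long as the arc is not shorter than a fixed multiple of
  \<open>1 / lac p M\<close>. The bound does not depend on \<open>K\<close>.\<close>

lemma integral_norm_lac_poly_le:
  fixes a b :: real
  assumes "p > 0" "a < b" and C: "1 + 8 / ((b - a) * lac p M) \<le> C"
  shows "(\<integral>\<theta>. norm (lac_poly p M K (cis \<theta>)) \<partial>lebesgue_on {a..b}) \<le> (b - a) * sqrt (2 * C / (real M + 1))"
proof -
  let ?L = "lebesgue_on {a..b}"
  interpret finite_measure ?L by (rule finite_measure_lebesgue_on) simp
  define s where "s = sqrt (2 * C / (real M + 1))"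
  have Np: "real (lac p M) > 0" using lac_pos assms(1) by simp
  then have "8 / ((b - a) * lac p M) \<ge> 0" using assms(2) by simp
  then have "C > 0" using C by linarith
  then have s: "s > 0" "s\<^sup>2 = 2 * C / (real M + 1)"
    by (simp_all add: s_def)
  have isq: "integrable ?L (\<lambda>\<theta>. (norm (lac_poly p M K (cis \<theta>)))\<^sup>2)"
  proof -
    have "continuous_on (cbox a b) (\<lambda>\<theta>. (norm (lac_poly p M K (cis \<theta>)))\<^sup>2)"
      by (intro continuous_intros continuous_on_compose2[OF continuous_on_lac_poly[of UNIV]]
          continuous_on_cis) auto
    from continuous_imp_integrable[OF this] show ?thesis by simp
  qed
  have "(\<integral>\<theta>. (norm (lac_poly p M K (cis \<theta>)))\<^sup>2 \<partial>?L)
      \<le> (b - a + 8 / lac p M) * (\<Sum>n\<in>{M..<K}. (1 / real (n + 1))\<^sup>2)"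
    unfolding lac_poly_def
    by (intro integral_norm_sq_lacunary) (use assms lac_pos in \<open>auto simp: lac_Suc\<close>)
  also have "\<dots> \<le> (b - a + 8 / lac p M) * (2 / (real M + 1))"
    using assms(2) Np by (intro mult_left_mono sum_inverse_squares_le) auto
  also have "b - a + 8 / lac p M = (b - a) * (1 + 8 / ((b - a) * lac p M))"
    using assms(2) Np by (simp add: field_simps)
  also have "\<dots> * (2 / (real M + 1)) \<le> (b - a) * C * (2 / (real M + 1))"
    using assms(2) C by (intro mult_left_mono mult_right_mono) auto
  also have "\<dots> = (b - a) * s\<^sup>2" by (simp add: s)
  finally have sq: "(\<integral>\<theta>. (norm (lac_poly p M K (cis \<theta>)))\<^sup>2 \<partial>?L) \<le> (b - a) * s\<^sup>2" .
  \<comment> \<open>AM-GM with the scale \<open>s\<close> in place of the Cauchy--Schwarz inequality\<close>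
  have "(\<integral>\<theta>. norm (lac_poly p M K (cis \<theta>)) \<partial>?L)
      \<le> (\<integral>\<theta>. s / 2 + (norm (lac_poly p M K (cis \<theta>)))\<^sup>2 / (2 * s) \<partial>?L)"
  proof (rule integral_mono)
    show "x \<le> s / 2 + x\<^sup>2 / (2 * s)" for x
      using sum_squares_bound[of s x] s by (simp add: field_simps power2_eq_square)
  qed (use integrable_lac_poly isq in auto)
  also have "\<dots> = (b - a) * s / 2 + (\<integral>\<theta>. (norm (lac_poly p M K (cis \<theta>)))\<^sup>2 \<partial>?L) / (2 * s)"
    using isq assms by (simp add: measure_lebesgue_on_Icc)
  also have "\<dots> \<le> (b - a) * s / 2 + (b - a) * s\<^sup>2 / (2 * s)"
    using sq s by (intro add_left_mono divide_right_mono) auto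
  also have "\<dots> = (b - a) * s"
    using s(1) by (simp add: power2_eq_square)
  finally show ?thesis by (simp add: s_def)
qed

text \<open>The sum is dominated by its last term, which the ratio 10000 makes small against the
  next one. The induction step amounts to \<open>41 * (M + 2) \<le> 10000 * (M + 1)\<close>, so 40
  leaves ample room.\<close>

lemma sum_lac_le: "(\<Sum>n<M. real (lac p n) / real (n + 1)) \<le> lac p M / (40 * (real M + 1))"
proof (induction M)
  case (Suc M)
  have "(\<Sum>n<Suc M. real (lac p n) / real (n + 1))
      \<le> lac p M / (40 * (real M + 1)) + lac p M / (real M + 1)"
    unfolding sum.lessThan_Suc using Suc by (intro add_mono) (simp_all add: add.commute)
  also have "\<dots> \<le> 10000 * lac p M / (40 * (real (Suc M) + 1))"
    by (simp add: divide_simps) (simp add: algebra_simps)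
  finally show ?case by (simp add: lac_Suc)
qed simp

lemma norm_cis_diff_le: "norm (cis s - cis t) \<le> \<bar>s - t\<bar>"
proof -
  have "cis s - cis t = cis t * (cis (s - t) - 1)"
    by (simp add: right_diff_distrib cis_mult)
  then have "norm (cis s - cis t) = norm (exp (\<i> * of_real (s - t)) - 1)"
    by (simp add: norm_mult del: of_real_diff flip: cis_conv_exp)
  also have "\<dots> = 2 * \<bar>sin ((s - t) / 2)\<bar>"
    by (rule dist_exp_i_1)
  also have "\<dots> \<le> 2 * \<bar>(s - t) / 2\<bar>"
    by (intro mult_left_mono abs_sin_x_le_abs_x) auto
  finally show ?thesis by simp
qed

text \<open>On the circle the power with exponent \<open>N\<close> is Lipschitz in the angle with
  constant \<open>N\<close>, and the weighted sum of these constants is controlled by the first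
  exponent left out.\<close>

lemma lac_poly_lipschitz:
  "norm (lac_poly p 0 M (cis s) - lac_poly p 0 M (cis t)) \<le> lac p M / (40 * (real M + 1)) * \<bar>s - t\<bar>"
proof -
  have "norm (lac_poly p 0 M (cis s) - lac_poly p 0 M (cis t))
      \<le> (\<Sum>n<M. norm (complex_of_real (1 / real (n + 1)) * (cis s ^ lac p n - cis t ^ lac p n)))"
    unfolding lac_poly_def lessThan_atLeast0
    by (simp only: sum_subtractf[symmetric] right_diff_distrib[symmetric] norm_sum)
  also have "\<dots> \<le> (\<Sum>n<M. real (lac p n) / real (n + 1) * \<bar>s - t\<bar>)"
  proof (rule sum_mono)
    fix n
    have "norm (cis s ^ lac p n - cis t ^ lac p n) \<le> lac p n * norm (cis s - cis t)"
      by (rule norm_power_diff) auto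
    also have "\<dots> \<le> lac p n * \<bar>s - t\<bar>"
      by (intro mult_left_mono norm_cis_diff_le) auto
    finally have "norm (cis s ^ lac p n - cis t ^ lac p n) / real (n + 1) \<le> lac p n * \<bar>s - t\<bar> / real (n + 1)"
      by (rule divide_right_mono) simp
    moreover have "norm (complex_of_real (1 / real (n + 1)) * (cis s ^ lac p n - cis t ^ lac p n))
        = norm (cis s ^ lac p n - cis t ^ lac p n) / real (n + 1)"
      unfolding norm_mult norm_of_real by simp
    ultimately show "norm (complex_of_real (1 / real (n + 1)) * (cis s ^ lac p n - cis t ^ lac p n))
        \<le> real (lac p n) / real (n + 1) * \<bar>s - t\<bar>"
      by simp
  qed
  also have "\<dots> \<le> lac p M / (40 * (real M + 1)) * \<bar>s - t\<bar>"
    unfolding sum_distrib_right[symmetric] by (intro mult_right_mono sum_lac_le) auto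
  finally show ?thesis .
qed

section \<open>Convergence of the blocks to the boundary function\<close>

lemma sum_lac_poly_blocks:
  "(\<Sum>k<n. lac_poly p (4 ^ k - 1) (4 ^ Suc k - 1) w) = lac_poly p 0 (4 ^ n - 1) w"
proof (induction n)
  case (Suc n)
  have "(4::nat) ^ n - 1 \<le> 4 ^ Suc n - 1" by (intro diff_le_mono power_increasing) auto
  with Suc show ?case
    unfolding lac_poly_def by (simp only: sum.lessThan_Suc sum.atLeastLessThan_concat le0)
qed (simp add: lac_poly_def)

text \<open>Block \<open>k\<close> starts at index \<open>4 ^ k - 1\<close>, so its squared
  coefficients sum to order \<open>4 ^ - k\<close> and its L^1 norm is of order
  \<open>2 ^ - k\<close>. As all exponents are at least 1, one constant \<open>C\<close> serves
  every block, and the norms are summable.\<close>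

lemma
  fixes a b :: real
  assumes "p > 0" "a < b"
  shows integrable_lac_boundary: "integrable (lebesgue_on {a..b}) (\<lambda>\<theta>. lac_boundary p (cis \<theta>))"
    and lac_boundary_L1_limit:
      "(\<lambda>k. \<integral>\<theta>. norm (lac_boundary p (cis \<theta>) - lac_poly p 0 (4 ^ k - 1) (cis \<theta>)) \<partial>lebesgue_on {a..b})
         \<longlonglongrightarrow> 0"
proof -
  let ?L = "lebesgue_on {a..b}"
  let ?u = "\<lambda>k \<theta>. lac_poly p (4 ^ k - 1) (4 ^ Suc k - 1) (cis \<theta>)"
  define C where "C = 1 + 8 / (b - a)"
  have le: "(\<integral>\<theta>. norm (?u k \<theta>) \<partial>?L) \<le> (b - a) * sqrt (2 * C) * (1 / 2) ^ k" for k
  proof -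
    have "(b - a) * 1 \<le> (b - a) * lac p (4 ^ k - 1)"
      using assms lac_pos[of p "4 ^ k - 1"] by (intro mult_left_mono) auto
    then have "8 / ((b - a) * lac p (4 ^ k - 1)) \<le> 8 / (b - a)"
      using assms by (intro frac_le) auto
    then have "(\<integral>\<theta>. norm (?u k \<theta>) \<partial>?L) \<le> (b - a) * sqrt (2 * C / (real (4 ^ k - 1) + 1))"
      using assms by (intro integral_norm_lac_poly_le) (auto simp: C_def)
    also have "real (4 ^ k - 1) + 1 = (2 ^ k)\<^sup>2"
      by (simp add: of_nat_diff power2_eq_square flip: power_mult_distrib)
    also have "sqrt (2 * C / (2 ^ k)\<^sup>2) = sqrt (2 * C) * (1 / 2) ^ k"
      by (simp add: real_sqrt_divide power_divide)
    finally show ?thesis by simp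
  qed
  have sum: "summable (\<lambda>k. \<integral>\<theta>. norm (?u k \<theta>) \<partial>?L)"
    by (rule summable_comparison_test'[where g = "\<lambda>k. (b - a) * sqrt (2 * C) * (1 / 2) ^ k" and N = 0])
       (use le in \<open>auto intro!: summable_mult summable_geometric\<close>)
  show "integrable ?L (\<lambda>\<theta>. lac_boundary p (cis \<theta>))"
    unfolding lac_boundary_def by (rule integral_suminf_partial_L1(1)[OF integrable_lac_poly sum])
  show "(\<lambda>k. \<integral>\<theta>. norm (lac_boundary p (cis \<theta>) - lac_poly p 0 (4 ^ k - 1) (cis \<theta>)) \<partial>?L) \<longlonglongrightarrow> 0"
    using integral_suminf_partial_L1(2)[OF integrable_lac_poly sum]
    unfolding lac_boundary_def sum_lac_poly_blocks .
qed

section \<open>Vanishing mean oscillation of the boundary function\<close>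

lemma lac_poly_split: "M \<le> K \<Longrightarrow> lac_poly p 0 K w = lac_poly p 0 M w + lac_poly p M K w"
  unfolding lac_poly_def by (simp add: sum.atLeastLessThan_concat)

text \<open>The index \<open>M\<close> separates the frequencies that are slow on the arc from those
  that oscillate on it. The slow part varies by at most \<open>10000 / (M + 1)\<close> and is absent
  for \<open>M = 0\<close>; the rest has L^1 average at most \<open>sqrt (18 / (M + 1))\<close>. The
  leading factor 2 is the price of subtracting a constant other than the mean.\<close>

lemma mean_osc_lac_boundary:
  fixes a b :: real
  assumes "p > 0" "a < b" and M: "(b - a) * lac p M \<ge> 1" "M = 0 \<or> (b - a) * lac p M \<le> 10000"
  shows "mean_osc (lac_boundary p) a b \<le> 2 * (10000 / (real M + 1) + sqrt (18 / (real M + 1)))"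
proof -
  let ?L = "lebesgue_on {a..b}" and ?\<phi> = "lac_boundary p"
  interpret finite_measure ?L by (rule finite_measure_lebesgue_on) simp
  \<comment> \<open>The value of the slow part at the left endpoint stands in for the mean.\<close>
  define c where "c = lac_poly p 0 M (cis a)"
  define D where "D = 10000 / (real M + 1) + sqrt (18 / (real M + 1))"
  define e where "e k = (\<integral>\<theta>. norm (?\<phi> (cis \<theta>) - lac_poly p 0 (4 ^ k - 1) (cis \<theta>)) \<partial>?L)" for k
  note int = integrable_lac_boundary[OF assms(1,2)] integrable_lac_poly
  have low: "norm (lac_poly p 0 M (cis \<theta>) - c) \<le> 10000 / (real M + 1)" if "\<theta> \<in> {a..b}" for \<theta>
  proof (cases "M = 0")
    case True
    then show ?thesis by (simp add: c_def lac_poly_def)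
  next
    case False
    have "norm (lac_poly p 0 M (cis \<theta>) - c) \<le> lac p M / (40 * (real M + 1)) * \<bar>\<theta> - a\<bar>"
      unfolding c_def by (rule lac_poly_lipschitz)
    also have "\<dots> \<le> lac p M / (real M + 1) * (b - a)"
      using that by (intro mult_mono) (auto intro!: divide_left_mono)
    also have "\<dots> \<le> 10000 / (real M + 1)"
      using M(2) False by (simp add: divide_right_mono mult.commute)
    finally show ?thesis .
  qed
  have le: "(\<integral>\<theta>. norm (?\<phi> (cis \<theta>) - c) \<partial>?L) \<le> e k + (b - a) * D" if k: "M \<le> 4 ^ k - 1" for k
  proof -
    have "(\<integral>\<theta>. norm (?\<phi> (cis \<theta>) - c) \<partial>?L)
        \<le> (\<integral>\<theta>. norm (?\<phi> (cis \<theta>) - lac_poly p 0 (4 ^ k - 1) (cis \<theta>))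
              + (norm (lac_poly p M (4 ^ k - 1) (cis \<theta>)) + 10000 / (real M + 1)) \<partial>?L)"
    proof (rule integral_mono)
      fix \<theta> assume "\<theta> \<in> space ?L"
      then have t: "\<theta> \<in> {a..b}" by simp
      have "?\<phi> (cis \<theta>) - c = (?\<phi> (cis \<theta>) - lac_poly p 0 (4 ^ k - 1) (cis \<theta>))
          + (lac_poly p M (4 ^ k - 1) (cis \<theta>) + (lac_poly p 0 M (cis \<theta>) - c))"
        using lac_poly_split[OF k] by simp
      also have "norm \<dots> \<le> norm (?\<phi> (cis \<theta>) - lac_poly p 0 (4 ^ k - 1) (cis \<theta>))
          + (norm (lac_poly p M (4 ^ k - 1) (cis \<theta>)) + norm (lac_poly p 0 M (cis \<theta>) - c))"
        by (intro norm_triangle_mono order_refl)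
      finally show "norm (?\<phi> (cis \<theta>) - c) \<le> norm (?\<phi> (cis \<theta>) - lac_poly p 0 (4 ^ k - 1) (cis \<theta>))
          + (norm (lac_poly p M (4 ^ k - 1) (cis \<theta>)) + 10000 / (real M + 1))"
        using low[OF t] by linarith
    qed (use int in auto)
    also have "\<dots> = e k + ((\<integral>\<theta>. norm (lac_poly p M (4 ^ k - 1) (cis \<theta>)) \<partial>?L) + (b - a) * (10000 / (real M + 1)))"
      using int assms(2) by (simp add: e_def measure_lebesgue_on_Icc)
    \<comment> \<open>Here \<open>C = 9\<close> is admissible, because
      \<open>(b - a) * lac p M \<ge> 1\<close> makes the off-diagonal loss at most 8.\<close>
    also have "(\<integral>\<theta>. norm (lac_poly p M (4 ^ k - 1) (cis \<theta>)) \<partial>?L) \<le> (b - a) * sqrt (2 * 9 / (real M + 1))"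
      using assms(1,2) M(1) by (intro integral_norm_lac_poly_le) (auto simp: divide_simps)
    finally show ?thesis by (simp add: D_def algebra_simps)
  qed
  \<comment> \<open>The bound holds for all large \<open>k\<close> with the same \<open>D\<close>,
    so letting \<open>k\<close> tend to infinity removes the approximation error
    \<open>e k\<close>.\<close>
  have "(\<lambda>k. e k + (b - a) * D) \<longlonglongrightarrow> 0 + (b - a) * D"
    unfolding e_def by (intro tendsto_intros lac_boundary_L1_limit assms)
  moreover have "eventually (\<lambda>k. (\<integral>\<theta>. norm (?\<phi> (cis \<theta>) - c) \<partial>?L) \<le> e k + (b - a) * D) sequentially"
  proof (rule eventually_sequentiallyI)
    fix k assume "M \<le> k"
    moreover have "k < 4 ^ k" by (rule power_gt_expt) simp
    ultimately show "(\<integral>\<theta>. norm (?\<phi> (cis \<theta>) - c) \<partial>?L) \<le> e k + (b - a) * D"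
      by (intro le) linarith
  qed
  ultimately have "(\<integral>\<theta>. norm (?\<phi> (cis \<theta>) - c) \<partial>?L) \<le> (b - a) * D"
    using tendsto_lowerbound[OF _ _ sequentially_bot] by fastforce
  then have "2 * (\<integral>\<theta>. norm (?\<phi> (cis \<theta>) - c) \<partial>?L) / (b - a) \<le> 2 * D"
    using assms(2) by (simp add: field_simps)
  then show ?thesis
    using mean_osc_le[OF assms(2) int(1), of c] by (simp add: D_def)
qed

text \<open>Take the least \<open>M\<close> satisfying the first inequality. If it is positive, its
  predecessor fails that inequality, and passing from the predecessor to \<open>M\<close> multiplies
  by exactly 10000.\<close>

lemma lac_scale_exists:
  fixes l :: real
  assumes "p > 0" "l > 0"
  obtains M where "l * lac p M \<ge> 1" "M = 0 \<or> l * lac p M \<le> 10000"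
proof -
  define M where "M = (LEAST M. l * lac p M \<ge> 1)"
  obtain n where "10000 ^ n > 1 / l" using real_arch_pow[of 10000 "1 / l"] by auto
  then have "1 \<le> l * 10000 ^ n" using assms by (simp add: field_simps)
  also have "\<dots> \<le> l * lac p n" using assms by (intro mult_left_mono) (auto simp: lac_def)
  finally have 1: "l * lac p M \<ge> 1" unfolding M_def by (rule LeastI)
  have 2: "l * lac p M \<le> 10000" if nz: "M \<noteq> 0"
  proof -
    obtain m where m: "M = Suc m" using not0_implies_Suc[OF nz] by blast
    then have "m < M" by simp
    then have "\<not> l * lac p m \<ge> 1"
      unfolding M_def by (rule not_less_Least)
    then show ?thesis by (simp add: m lac_Suc)
  qed
  show ?thesis
    by (rule that[OF 1]) (use 2 in auto)
qed

text \<open>The oscillation is at most \<open>g M\<close> at the scale \<open>M\<close> of the arc.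
  This is bounded over all \<open>M\<close>, and it tends to 0 because short arcs have large
  \<open>M\<close>.\<close>

lemma lac_boundary_in_VMO:
  assumes p: "p > 0"
  shows "lac_boundary p \<in> VMO"
proof -
  define g where "g M = 2 * (10000 / (real M + 1) + sqrt (18 / (real M + 1)))" for M
  have osc: "\<exists>M. (b - a) * lac p M \<ge> 1 \<and> mean_osc (lac_boundary p) a b \<le> g M"
    if "a < b" for a b :: real
    using lac_scale_exists[OF p, of "b - a"] mean_osc_lac_boundary[OF p that] that
    unfolding g_def by (metis diff_gt_0_iff_gt)
  show ?thesis
  proof (rule VMOI)
    fix a b :: real assume ab: "a < b"
    show "integrable (lebesgue_on {a..b}) (\<lambda>\<theta>. lac_boundary p (cis \<theta>))"
      by (rule integrable_lac_boundary[OF p ab])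
    obtain M where "mean_osc (lac_boundary p) a b \<le> g M" using osc[OF ab] by blast
    also have "\<dots> \<le> 2 * (10000 + sqrt 18)"
      unfolding g_def by (intro mult_left_mono add_mono) (auto simp: divide_simps)
    finally show "mean_osc (lac_boundary p) a b \<le> 2 * (10000 + sqrt 18)" .
  next
    fix \<epsilon> :: real assume e: "\<epsilon> > 0"
    have "(\<lambda>M. c / (real M + 1)) \<longlonglongrightarrow> 0" for c
      using LIMSEQ_Suc[OF lim_const_over_n[of c]] by (simp add: add.commute)
    then have "g \<longlonglongrightarrow> 2 * (0 + sqrt 0)"
      unfolding g_def by (intro tendsto_intros)
    then have "eventually (\<lambda>M. g M < \<epsilon>) sequentially"
      using e by (intro order_tendstoD(2)) auto
    then obtain M0 where M0: "\<And>M. M \<ge> M0 \<Longrightarrow> g M < \<epsilon>" by (auto simp: eventually_sequentially)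
    have pos: "real (lac p M0) > 0" using lac_pos[OF p] by simp
    have "mean_osc (lac_boundary p) a b < \<epsilon>" if ab: "a < b" and l: "b - a < 1 / lac p M0" for a b
    proof -
      obtain M where M: "(b - a) * lac p M \<ge> 1" "mean_osc (lac_boundary p) a b \<le> g M"
        using osc[OF ab] by blast
      \<comment> \<open>An arc shorter than \<open>1 / lac p M0\<close> cannot satisfy
        \<open>(b - a) * lac p M \<ge> 1\<close> with a smaller index.\<close>
      have "M \<ge> M0"
      proof (rule ccontr)
        assume "\<not> M \<ge> M0"
        then have "(b - a) * lac p M \<le> (b - a) * lac p M0"
          using ab by (intro mult_left_mono of_nat_mono lac_mono) auto
        also have "\<dots> < 1" using l pos by (simp add: field_simps)
        finally show False using M(1) by simp
      qed
      then show ?thesis using M(2) M0 by fastforce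
    qed
    then show "\<exists>\<delta>>0. \<forall>a b. a < b \<longrightarrow> b \<le> a + 2 * pi \<longrightarrow> b - a < \<delta> \<longrightarrow> mean_osc (lac_boundary p) a b < \<epsilon>"
      using pos by (intro exI[of _ "1 / lac p M0"]) auto
  qed
qed

section \<open>The lacunary series and its derivative\<close>

lemma lac_ge:
  assumes "p > 0"
  shows "n \<le> lac p n"
proof -
  have "n < 10000 ^ n" by (rule power_gt_expt) simp
  moreover have "1 * 10000 ^ n \<le> p * 10000 ^ n"
    using assms by (intro mult_right_mono) auto
  ultimately show ?thesis unfolding lac_def by linarith
qed

text \<open>The series is dominated locally uniformly by a geometric one, which permits termwise
  differentiation.\<close>

lemma lac_fun_series:
  assumes "p > 0" "norm z < 1"
  shows lac_fun_sums: "(\<lambda>n. complex_of_real (1 / real (n + 1)) * z ^ lac p n) sums lac_fun p z"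
    and lac_fun_deriv_sums: "(\<lambda>n. complex_of_real (1 / real (n + 1)) * (of_nat (lac p n) * z ^ (lac p n - 1)))
          sums deriv (lac_fun p) z"
    and lac_fun_field_differentiable: "lac_fun p field_differentiable at z"
proof -
  let ?f = "\<lambda>n z. complex_of_real (1 / real (n + 1)) * z ^ lac p n"
  let ?f' = "\<lambda>n z. complex_of_real (1 / real (n + 1)) * (of_nat (lac p n) * z ^ (lac p n - 1))"
  have "\<exists>g g'. \<forall>x\<in>ball 0 1. (\<lambda>n. ?f n x) sums g x \<and> (\<lambda>n. ?f' n x) sums g' x \<and> (g has_field_derivative g' x) (at x)"
  proof (rule series_and_derivative_comparison_complex)
    show "(?f n has_field_derivative ?f' n x) (at x)" for n x
      by (rule DERIV_cmult) (auto intro!: derivative_eq_intros)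
    fix x :: complex assume x: "x \<in> ball 0 1"
    \<comment> \<open>Points within \<open>(1 - norm x) / 2\<close> of \<open>x\<close> have modulus
      at most \<open>R < 1\<close>. Since \<open>lac p n \<ge> n\<close>, the \<open>n\<close>-th
      term there is at most \<open>R ^ n\<close>.\<close>
    define R where "R = (1 + norm x) / 2"
    have R: "0 \<le> R" "R < 1" using x by (auto simp: R_def)
    have "norm (?f n y) \<le> norm (complex_of_real (R ^ n))" if y: "y \<in> ball x ((1 - norm x) / 2) \<inter> ball 0 1" for n y
    proof -
      have "norm y \<le> norm x + norm (y - x)" using norm_triangle_ineq[of x "y - x"] by simp
      also have "\<dots> \<le> R" using y by (simp add: R_def dist_norm norm_minus_commute field_simps)
      finally have "norm y ^ lac p n \<le> R ^ lac p n" by (intro power_mono) auto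
      also have "\<dots> \<le> R ^ n" using R lac_ge[OF assms(1), of n] by (intro power_decreasing) auto
      finally have le: "norm y ^ lac p n \<le> R ^ n" .
      have "norm (?f n y) = norm y ^ lac p n / real (n + 1)"
        unfolding norm_mult norm_of_real norm_power by simp
      also have "\<dots> \<le> norm y ^ lac p n / 1" by (intro divide_left_mono) auto
      finally show ?thesis using le R by (simp add: norm_power)
    qed
    moreover have "summable (\<lambda>n. complex_of_real (R ^ n))"
      using R by (intro summable_of_real summable_geometric) auto
    moreover have "range (\<lambda>n. complex_of_real (R ^ n)) \<subseteq> \<real>\<^sub>\<ge>\<^sub>0"
      using R by (auto simp del: of_real_power)
    moreover have "0 < (1 - norm x) / 2" using x by simp
    ultimately show "\<exists>d h. 0 < d \<and> summable h \<and> range h \<subseteq> \<real>\<^sub>\<ge>\<^sub>0 \<and>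
        (\<forall>\<^sub>F n in sequentially. \<forall>y\<in>ball x d \<inter> ball 0 1. norm (?f n y) \<le> cmod (h n))"
      by (intro exI[of _ "(1 - norm x) / 2"] exI[of _ "\<lambda>n. complex_of_real (R ^ n)"] conjI
          always_eventually allI ballI)
  qed simp
  then obtain g g' where g: "\<And>x. x \<in> ball 0 1 \<Longrightarrow> (\<lambda>n. ?f n x) sums g x"
      "\<And>x. x \<in> ball 0 1 \<Longrightarrow> (\<lambda>n. ?f' n x) sums g' x"
      "\<And>x. x \<in> ball 0 1 \<Longrightarrow> (g has_field_derivative g' x) (at x)"
    by blast
  have eq: "lac_fun p x = g x" if "x \<in> ball 0 1" for x
    unfolding lac_fun_def using sums_unique[OF g(1)[OF that]] by simp
  have z: "z \<in> ball 0 1" using assms by simp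
  have der: "(lac_fun p has_field_derivative g' z) (at z)"
    by (rule has_field_derivative_transform_within_open[OF g(3)[OF z] open_ball z]) (use eq in simp)
  show "(\<lambda>n. ?f n z) sums lac_fun p z" using g(1)[OF z] eq[OF z] by simp
  show "(\<lambda>n. ?f' n z) sums deriv (lac_fun p) z" using g(2)[OF z] DERIV_imp_deriv[OF der] by simp
  show "lac_fun p field_differentiable at z" using der by (auto simp: field_differentiable_def)
qed

lemma lac_fun_holomorphic: "p > 0 \<Longrightarrow> lac_fun p holomorphic_on ball 0 1"
  unfolding holomorphic_on_def
  by (auto intro: field_differentiable_at_within[OF lac_fun_field_differentiable])

text \<open>The partial sums of length \<open>4 ^ k - 1\<close> play two roles: they converge in L^1
  to the boundary function on the circle, and pointwise to \<open>lac_fun p\<close> in the disc. The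
  L^1 limit lemma then identifies the Poisson extension.\<close>

lemma lac_fun_in_VMOA:
  assumes p: "p > 0"
  shows "lac_fun p \<in> VMOA"
proof -
  have "lac_fun p z = poisson_extension (lac_boundary p) z" if z: "z \<in> ball 0 1" for z
  proof (rule sym, rule poisson_extension_L1_limit)
    show "integrable (lebesgue_on {-pi..pi}) (\<lambda>\<theta>. lac_boundary p (cis \<theta>))"
      using p by (intro integrable_lac_boundary) auto
    show "(\<lambda>k. \<integral>\<theta>. norm (lac_boundary p (cis \<theta>) - lac_poly p 0 (4 ^ k - 1) (cis \<theta>)) \<partial>lebesgue_on {-pi..pi}) \<longlonglongrightarrow> 0"
      using p by (intro lac_boundary_L1_limit) auto
    have "(\<lambda>n. lac_poly p 0 n z) \<longlonglongrightarrow> lac_fun p z"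
      using lac_fun_sums[OF p, of z] z by (simp add: sums_def lac_poly_def lessThan_atLeast0)
    moreover have "strict_mono (\<lambda>k::nat. 4 ^ k - 1 :: nat)"
      by (intro strict_monoI diff_less_mono power_strict_increasing) auto
    ultimately show "(\<lambda>k. lac_poly p 0 (4 ^ k - 1) z) \<longlonglongrightarrow> lac_fun p z"
      using LIMSEQ_subseq_LIMSEQ unfolding o_def by blast
  qed (use z in \<open>auto intro: continuous_on_lac_poly holomorphic_on_lac_poly\<close>)
  then show ?thesis
    using lac_boundary_in_VMO[OF p] lac_fun_holomorphic[OF p] by (auto simp: VMOA_def)
qed

section \<open>Constant multiples in VMOA\<close>

lemma mean_osc_cmult: "mean_osc (\<lambda>w. c * \<phi> w) a b = norm c * mean_osc \<phi> a b"
proof -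
  have "arc_mean (\<lambda>w. c * \<phi> w) a b = c * arc_mean \<phi> a b"
    by (simp add: arc_mean_def)
  then have "norm (c * \<phi> w - arc_mean (\<lambda>w. c * \<phi> w) a b) = norm c * norm (\<phi> w - arc_mean \<phi> a b)" for w
    by (simp flip: right_diff_distrib norm_mult)
  then show ?thesis by (simp add: mean_osc_def)
qed

lemma VMOA_cmult:
  assumes f: "f \<in> VMOA" and c: "c \<noteq> 0"
  shows "(\<lambda>z. c * f z) \<in> VMOA"
proof -
  obtain \<phi> where \<phi>: "\<phi> \<in> VMO" "\<And>z. z \<in> ball 0 1 \<Longrightarrow> f z = poisson_extension \<phi> z"
    and hol: "f holomorphic_on ball 0 1"
    using f by (auto simp: VMOA_def)
  have "(\<lambda>w. c * \<phi> w) \<in> circle_L1"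
    using \<phi>(1) by (auto simp: VMO_def BMO_def circle_L1_def)
  moreover have "bmo_seminorm (\<lambda>w. c * \<phi> w) < \<infinity>"
  proof -
    have "bmo_seminorm (\<lambda>w. c * \<phi> w) \<le> ereal (norm c) * bmo_seminorm \<phi>"
      unfolding bmo_seminorm_def
    proof (rule SUP_least, clarify)
      fix a b assume "(a, b) \<in> arcs"
      then have "ereal (mean_osc \<phi> a b) \<le> (SUP (a, b)\<in>arcs. ereal (mean_osc \<phi> a b))"
        by (metis (mono_tags, lifting) SUP_upper case_prod_conv)
      then have "ereal (norm c) * ereal (mean_osc \<phi> a b) \<le> ereal (norm c) * (SUP (a, b)\<in>arcs. ereal (mean_osc \<phi> a b))"
        by (intro ereal_mult_left_mono) auto
      then show "ereal (mean_osc (\<lambda>w. c * \<phi> w) a b) \<le> ereal (norm c) * (SUP (a, b)\<in>arcs. ereal (mean_osc \<phi> a b))"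
        by (simp add: mean_osc_cmult)
    qed
    moreover have "bmo_seminorm \<phi> < \<infinity>" using \<phi>(1) by (auto simp: VMO_def BMO_def)
    ultimately show ?thesis
      using c by (cases "bmo_seminorm \<phi>") (auto split: if_splits intro: le_less_trans)
  qed
  moreover have "\<exists>\<delta>>0. \<forall>(a, b)\<in>arcs. b - a < \<delta> \<longrightarrow> mean_osc (\<lambda>w. c * \<phi> w) a b < \<epsilon>" if "\<epsilon> > 0" for \<epsilon>
  proof -
    have "\<epsilon> / norm c > 0" using that c by simp
    then obtain \<delta> where "\<delta> > 0" "\<forall>(a, b)\<in>arcs. b - a < \<delta> \<longrightarrow> mean_osc \<phi> a b < \<epsilon> / norm c"
      using \<phi>(1) unfolding VMO_def by blast
    then show ?thesis
      using c by (intro exI[of _ \<delta>]) (auto simp: mean_osc_cmult field_simps)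
  qed
  ultimately have "(\<lambda>w. c * \<phi> w) \<in> VMO"
    by (auto simp: VMO_def BMO_def)
  moreover have "poisson_extension (\<lambda>w. c * \<phi> w) z = c * poisson_extension \<phi> z" for z
    unfolding poisson_extension_def mult.left_commute[of _ c]
    by (simp only: set_integral_mult_right times_divide_eq_right)
  ultimately show ?thesis
    using \<phi>(2) hol unfolding VMOA_def
    by (intro CollectI conjI bexI[of _ "\<lambda>w. c * \<phi> w"]) (auto intro!: holomorphic_intros)
qed

section \<open>Lower bound for the derivative at the dominant scale\<close>

text \<open>With \<open>k = N - 1 > 0\<close>, the number \<open>(1 - 1 / N) ^ k\<close> is the
  reciprocal of \<open>(1 + 1 / k) ^ k\<close>, which is at most \<open>exp 1\<close> and hence at
  most 3.\<close>

lemma power_one_minus_ge_third: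
  fixes x :: real
  assumes "N > 0" and x: "1 - 1 / real N \<le> x"
  shows "1 / 3 \<le> x ^ (N - 1)"
proof (cases "N = 1")
  case False
  define k where "k = N - 1"
  have k: "k > 0" "real N = real k + 1" using assms(1) False by (auto simp: k_def)
  have "(1 + 1 / real k) ^ k \<le> exp 1"
    using exp_ge_one_plus_x_over_n_power_n[of k 1] k by simp
  then have "(1 + 1 / real k) ^ k \<le> 3" using exp_le by linarith
  then have "1 / 3 \<le> 1 / (1 + 1 / real k) ^ k"
    using k by (intro divide_left_mono) (auto intro!: mult_pos_pos zero_less_power add_pos_pos)
  also have "\<dots> = (1 - 1 / real N) ^ k"
    using k by (simp add: field_simps flip: power_one_over)
  also have "\<dots> \<le> x ^ k"
    using x k by (intro power_mono) auto
  finally show ?thesis by (simp add: k_def)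
qed simp

text \<open>The power is at most \<open>exp (1 - y)\<close>, and
  \<open>exp y \<ge> (y / 4) ^ 4\<close>; the constant is \<open>768 = 3 * 4 ^ 4\<close>.
  Fourth-order decay is enough to beat the growth of the exponents in the tail of the
  derivative.\<close>

lemma power_one_minus_decay:
  fixes d :: real
  assumes d: "0 < d" "d \<le> 1" and K: "K > 0" and y: "0 < y" "y \<le> d * real K"
  shows "(1 - d) ^ (K - 1) \<le> 768 / y ^ 4"
proof -
  have "(1 - d) ^ (K - 1) \<le> exp (- d) ^ (K - 1)"
    using d exp_ge_add_one_self[of "- d"] by (intro power_mono) auto
  also have "\<dots> = exp (d - d * real K)"
    using K by (simp add: of_nat_diff algebra_simps flip: exp_of_nat_mult)
  also have "\<dots> \<le> exp (1 - y)" using d y by simp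
  also have "\<dots> = exp 1 / exp y" by (rule exp_diff)
  also have "\<dots> \<le> 3 / (y / 4) ^ 4"
  proof (rule frac_le)
    have "(y / 4) ^ 4 \<le> (1 + y / 4) ^ 4" using y by (intro power_mono) auto
    also have "\<dots> \<le> exp y"
      using exp_ge_one_plus_x_over_n_power_n[of 4 y] y by simp
    finally show "(y / 4) ^ 4 \<le> exp y" .
  qed (use y exp_le in auto)
  finally show ?thesis by (simp add: power_divide)
qed

text \<open>The \<open>n\<close>-th term dominates. In units of \<open>B\<close> it is at least 1/3,
  the earlier terms contribute at most 1/40 because the exponents grow fast, and the later ones are
  small because the powers of \<open>norm z\<close> decay.\<close>

lemma norm_deriv_lac_fun_ge:
  assumes p: "p > 0" and z: "norm z < 1"
    and N: "(1 - norm z) * lac p n \<le> 1" "1 \<le> 100 * (1 - norm z) * lac p n"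
  shows "lac p n / (8 * (real n + 1)) \<le> norm (deriv (lac_fun p) z)"
proof -
  define T where "T m = complex_of_real (1 / real (m + 1)) * (of_nat (lac p m) * z ^ (lac p m - 1))" for m
  define d where "d = 1 - norm z"
  define B where "B = real (lac p n) / (real n + 1)"
  have nT: "norm (T m) = lac p m / real (m + 1) * norm z ^ (lac p m - 1)" for m
    unfolding T_def norm_mult norm_of_real norm_of_nat norm_power by simp
  have Np: "real (lac p n) > 0" using lac_pos[OF p] by simp
  have d: "0 < d" "d \<le> 1" using z by (auto simp: d_def)
  have B: "B > 0" using Np by (simp add: B_def)
  have main: "B / 3 \<le> norm (T n)"
  proof -
    have "1 / 3 \<le> norm z ^ (lac p n - 1)"
      using N(1) lac_pos[OF p, of n] by (intro power_one_minus_ge_third) (auto simp: field_simps)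
    then have "B * (1 / 3) \<le> B * norm z ^ (lac p n - 1)"
      using B by (intro mult_left_mono) auto
    then show ?thesis by (simp add: nT B_def add.commute)
  qed
  have low: "norm (\<Sum>m<n. T m) \<le> B / 40"
  proof -
    have "norm (\<Sum>m<n. T m) \<le> (\<Sum>m<n. real (lac p m) / real (m + 1))"
    proof (rule sum_norm_le)
      fix m
      have "norm z ^ (lac p m - 1) \<le> 1" using z by (intro power_le_one) auto
      then show "norm (T m) \<le> real (lac p m) / real (m + 1)"
        unfolding nT by (intro mult_left_le) auto
    qed
    also have "\<dots> \<le> lac p n / (40 * (real n + 1))" by (rule sum_lac_le)
    finally show ?thesis by (simp add: B_def field_simps)
  qed
  have high: "norm (T (j + Suc n)) \<le> B * (768 / 10000) * (1 / 2) ^ j" for j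
  proof -
    define K where "K = lac p (j + Suc n)"
    \<comment> \<open>This is the lower bound for \<open>d * K\<close> obtained from
      \<open>100 * d * lac p n \<ge> 1\<close>, since \<open>K\<close> equals
      \<open>100 * y * lac p n\<close>.\<close>
    define y :: real where "y = 100 * 10000 ^ j"
    have K: "real K = 100 * y * real (lac p n)"
      by (simp add: K_def y_def lac_def power_add)
    have y: "y > 0" by (simp add: y_def)
    have "y * 1 \<le> y * (100 * d * lac p n)"
      using N(2) y by (intro mult_left_mono) (auto simp: d_def)
    then have yK: "y \<le> d * real K" by (simp add: K mult_ac)
    have "norm z ^ (K - 1) \<le> 768 / y ^ 4"
      using power_one_minus_decay[OF d _ y yK] lac_pos[OF p] by (simp add: d_def K_def)
    then have "real K / real (j + Suc n + 1) * norm z ^ (K - 1) \<le> real K / (real n + 1) * (768 / y ^ 4)"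
      by (intro mult_mono frac_le) auto
    \<comment> \<open>The factor \<open>100 * y\<close> by which \<open>K\<close> exceeds
      \<open>lac p n\<close> uses up one of the four powers of \<open>y\<close>. What remains is
      768/10000 at \<open>j = 0\<close> and decays much faster than \<open>2 ^ - j\<close>.\<close>
    also have "\<dots> = B * (76800 / y ^ 3)"
      using y by (simp add: K B_def field_simps power_numeral_reduce)
    also have "76800 / y ^ 3 \<le> 768 / 10000 * (1 / 2) ^ j"
    proof -
      have "(2::real) ^ j \<le> (10000 ^ j) ^ 3"
        unfolding power_mult[symmetric] mult.commute[of j] unfolding power_mult
        by (intro power_mono) auto
      then show ?thesis
        by (simp add: y_def power_mult_distrib power_divide divide_simps)
    qed
    finally show ?thesis
      using B by (simp add: nT K_def mult.assoc)
  qed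
  have sT: "T sums deriv (lac_fun p) z"
    unfolding T_def by (rule lac_fun_deriv_sums[OF p z])
  have geo: "(\<lambda>j. B * (768 / 10000) * (1 / 2) ^ j) sums (B * (768 / 10000) * 2)"
    using sums_mult[OF geometric_sums[of "1 / 2 :: real"], of "B * (768 / 10000)"] by simp
  have tail: "norm (\<Sum>j. T (j + Suc n)) \<le> B * (768 / 10000) * 2"
    using norm_suminf_le[OF high sums_summable[OF geo]] sums_unique[OF geo] by simp
  have "deriv (lac_fun p) z = (\<Sum>j. T (j + Suc n)) + ((\<Sum>m<n. T m) + T n)"
    using suminf_split_initial_segment[OF sums_summable[OF sT], of "Suc n"] sums_unique[OF sT] by simp
  then have "norm (T n) \<le> norm (deriv (lac_fun p) z) + norm (\<Sum>j. T (j + Suc n)) + norm (\<Sum>m<n. T m)"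
    using norm_triangle_ineq4[of "deriv (lac_fun p) z - (\<Sum>j. T (j + Suc n))" "\<Sum>m<n. T m"]
      norm_triangle_ineq4[of "deriv (lac_fun p) z" "\<Sum>j. T (j + Suc n)"] by simp
  \<comment> \<open>Numerically, 1/3 - 1/40 - 2 * 768/10000 is about 0.154 and exceeds 1/8.\<close>
  then have "B / 8 \<le> norm (deriv (lac_fun p) z)"
    using main low tail B by simp
  then show ?thesis by (simp add: B_def mult.commute)
qed

text \<open>The exponents for \<open>p = 1\<close> and \<open>p = 100\<close> together are all
  powers of 100. The least \<open>k\<close> with \<open>d * 100 ^ (k + 1) \<ge> 1\<close> gives the
  scale of \<open>d\<close>, and its parity selects \<open>p\<close>.\<close>

lemma lac_scale_covering:
  fixes d :: real
  assumes d: "0 < d" "d \<le> 1"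
  obtains p n where "p \<in> {1, 100}" "d * lac p n \<le> 1" "1 \<le> 100 * d * lac p n"
proof -
  define k where "k = (LEAST k. 1 \<le> d * 100 ^ Suc k)"
  obtain m where "100 ^ m > 1 / d" using real_arch_pow[of 100 "1 / d"] by auto
  then have "1 \<le> d * 100 ^ m" using d by (simp add: field_simps)
  also have "\<dots> \<le> d * 100 ^ Suc m" using d by simp
  finally have 1: "1 \<le> d * 100 ^ Suc k" unfolding k_def by (rule LeastI)
  have 2: "d * 100 ^ k \<le> 1"
  proof (cases k)
    case (Suc m)
    then have "m < k" by simp
    then have "\<not> 1 \<le> d * 100 ^ Suc m" unfolding k_def by (rule not_less_Least)
    then show ?thesis by (simp add: Suc)
  qed (use d in simp)
  have sq: "(10000::real) ^ n = 100 ^ (2 * n)" for n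
    by (simp add: power_mult)
  show ?thesis
  proof (cases "even k")
    case True
    then obtain n where "k = 2 * n" by blast
    then show ?thesis using 1 2 by (intro that[of 1 n]) (auto simp: lac_def sq mult_ac)
  next
    case False
    then obtain n where "k = 2 * n + 1" by (rule oddE)
    then show ?thesis using 1 2 by (intro that[of 100 n]) (auto simp: lac_def sq mult_ac)
  qed
qed

(* The weight 1 / ((1 - |z|) |log (1 - |z|)|) is unbounded as z tends to 0, whereas the derivatives
   of f and g are bounded near 0, so no f, g satisfy the inequality near the origin.  Hence the
   logarithm is frozen at |z| = r for |z| < r, where r > 0 is arbitrarily small; for r <= |z| < 1
   the inequality is the original one. *)
theorem proposition2p2:
  fixes r :: real
  assumes "0 < r" and "r < 1"
  shows "\<exists>f\<in>VMOA. \<exists>g\<in>VMOA. \<forall>z\<in>ball (0::complex) 1.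
           norm (deriv f z) + norm (deriv g z)
             \<ge> 1 / ((1 - norm z) * \<bar>ln (1 - max r (norm z))\<bar>)"
proof -
  \<comment> \<open>The constant is chosen so that \<open>c * (n + 1)\<close> lies below the
    logarithm: \<open>- ln (1 - r)\<close> handles \<open>n = 0\<close>, and 1/2 handles
    \<open>n \<ge> 1\<close>, where \<open>(n + 1) / 2 \<le> n\<close>.\<close>
  define c where "c = min (- ln (1 - r)) (1 / 2)"
  have c: "c > 0" "c \<le> - ln (1 - r)" "c \<le> 1 / 2"
    using assms by (auto simp: c_def)
  \<comment> \<open>A factor 8 compensates the lower bound for the derivative, 100 the width of the
    range of radii served by one exponent, and \<open>1 / c\<close> the comparison of
    \<open>n + 1\<close> with the logarithm.\<close>
  define C where "C = 800 / c"
  have C: "C > 0" using c by (simp add: C_def)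
  define F where "F p z = complex_of_real C * lac_fun p z" for p z
  have F: "F p \<in> VMOA" if "p > 0" for p
    unfolding F_def using C by (intro VMOA_cmult lac_fun_in_VMOA that) auto
  have dF: "norm (deriv (F p) z) = C * norm (deriv (lac_fun p) z)" if "p > 0" "z \<in> ball 0 1" for p z
    unfolding F_def using that C
    by (subst deriv_cmult) (auto simp: norm_mult intro!: lac_fun_field_differentiable)
  have "1 / ((1 - norm z) * \<bar>ln (1 - max r (norm z))\<bar>) \<le> norm (deriv (F 1) z) + norm (deriv (F 100) z)"
    if z: "z \<in> ball 0 1" for z
  proof -
    define d where "d = 1 - norm z"
    have d: "0 < d" "d \<le> 1" using z by (auto simp: d_def)
    obtain p n where pn: "p \<in> {1, 100}" "d * lac p n \<le> 1" "1 \<le> 100 * d * lac p n"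
      using lac_scale_covering[OF d] .
    have p: "p > 0" using pn(1) by auto
    have Np: "real (lac p n) > 0" using lac_pos[OF p] by simp
    define L where "L = \<bar>ln (1 - max r (norm z))\<bar>"
    have m: "0 < 1 - max r (norm z)" "1 - max r (norm z) \<le> 1 - r" "1 - max r (norm z) \<le> d"
      using assms z by (auto simp: d_def)
    have L1: "L \<ge> c"
    proof -
      have "ln (1 - max r (norm z)) \<le> ln (1 - r)"
        using m assms by (subst ln_le_cancel_iff) auto
      then show ?thesis using c(2) by (simp add: L_def)
    qed
    \<comment> \<open>The dominant exponent is at least \<open>10000 ^ n\<close> and at most
      \<open>1 / d\<close>, so the logarithm of \<open>1 / d\<close> is at least
      \<open>n * ln 10000\<close>. Taking the maximum with \<open>r\<close> can only increase the
      absolute value of the logarithm.\<close>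
    have L2: "L \<ge> n"
    proof -
      have "1 - max r (norm z) \<le> 1 / 10000 ^ n"
      proof -
        have "(1 - max r (norm z)) * 10000 ^ n \<le> d * 10000 ^ n"
          using m(3) by (rule mult_right_mono) simp
        also have "\<dots> \<le> d * lac p n"
          using d p by (intro mult_left_mono) (auto simp: lac_def)
        also have "\<dots> \<le> 1" by (rule pn(2))
        finally show ?thesis by (simp add: pos_le_divide_eq)
      qed
      then have "ln (1 - max r (norm z)) \<le> ln (1 / 10000 ^ n)"
        using m(1) by (subst ln_le_cancel_iff) auto
      also have "\<dots> = - (n * ln 10000)" by (simp add: ln_div ln_realpow)
      also have "\<dots> \<le> - (real n * 1)"
      proof -
        have "1 \<le> ln (10000::real)" using exp_le by (subst ln_ge_iff) auto
        then show ?thesis by (intro le_imp_neg_le mult_left_mono) auto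
      qed
      finally show ?thesis by (simp add: L_def)
    qed
    have L: "c * (real n + 1) \<le> L"
    proof (cases "n = 0")
      case False
      have "c * (real n + 1) \<le> 1 / 2 * (real n + 1)" using c by (intro mult_right_mono) auto
      also have "\<dots> \<le> real n" using False by simp
      finally show ?thesis using L2 by simp
    qed (use L1 in simp)
    have "1 / (d * L) \<le> 1 / (d * (c * (real n + 1)))"
      using d c L by (intro divide_left_mono mult_left_mono mult_pos_pos) (auto intro: less_le_trans[OF _ L])
    also have "\<dots> = C * (1 / (100 * d) / (8 * (real n + 1)))"
    proof -
      have "1 / (d * (c * m)) = C * (1 / (100 * d) / (8 * m))" if "m > 0" for m
        using d c that by (simp add: C_def field_simps)
      then show ?thesis by simp
    qed
    also have "\<dots> \<le> C * (lac p n / (8 * (real n + 1)))"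
      using pn(3) d C by (intro mult_left_mono divide_right_mono) (auto simp: field_simps)
    also have "\<dots> \<le> C * norm (deriv (lac_fun p) z)"
      using norm_deriv_lac_fun_ge[OF p, of z n] z pn C by (intro mult_left_mono) (auto simp: d_def)
    also have "\<dots> = norm (deriv (F p) z)" using dF[OF p z] by simp
    also have "\<dots> \<le> norm (deriv (F 1) z) + norm (deriv (F 100) z)"
      using pn(1) by auto
    finally show ?thesis by (simp add: d_def L_def)
  qed
  then show ?thesis
    using F[of 1] F[of 100] by (intro bexI[of _ "F 1"] bexI[of _ "F 100"]) auto
qed

end
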